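(* Let $n\ge 1$ and $p\geq 2$ be integers, and let $G_{1},\ldots,G_{p}\subset\binom{[n]}{2}$ be 2-colored triangle free. Then \[ \prod_{i=1}^{p}e(G_i)\leq \left\lfloor\frac{n^{2}}{4}\right\rfloor^p . \] Moreover, equality holds if and only if $G_{1}=\cdots=G_{p}=K_{\lfloor \frac{n}{2}\rfloor, \lceil \frac{n}{2}\rceil}$, i.e. all $G_i$ are the same graph on $[n]$ and this graph is a complete bipartite graph with parts of sizes $\lfloor n/2\rfloor$ and $\lceil n/2\rceil$.
   Context: $[n]=\{1,\ldots,n\}$. Each $G_i\subset\binom{[n]}{2}$ is regarded as (the edge set of) a simple graph on the vertex set $[n]$, and $e(G_i)$ is its number of edges. The edge-colored multiple graph $G_1+\cdots+G_p$ is the multigraph on $[n]$ in which the edges of $G_i$ have color $i$ (so a pair may carry several colors). An edge-colored triangle is 2-colored if two of its edges have the same color and the third edge has a different color. The graphs $G_1,\ldots,G_p$ are 2-colored triangle free if $G_1+\cdots+G_p$ contains no 2-colored triangle; that is, there are no distinct vertices $x,y,z\in[n]$ and indices $i\neq j$ with $xy,xz\in E(G_i)$ and $yz\in E(G_j)$. *)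

theory Defs
  imports "HOL-Library.Ramsey"
begin

text \<open>
  A simple graph on a vertex set \<open>V\<close> is given by its edge set, a subset of
  \<open>nsets V 2\<close>; a graph family indexed by \<open>I\<close> stands for the edge-coloured multigraph
  in which the edges of \<open>G i\<close> have colour \<open>i\<close>.
\<close>

definition two_coloured_triangle_free ::
    "'a set \<Rightarrow> 'i set \<Rightarrow> ('i \<Rightarrow> 'a set set) \<Rightarrow> bool" where
  "two_coloured_triangle_free V I G \<longleftrightarrow>
     \<not> (\<exists>x\<in>V. \<exists>y\<in>V. \<exists>z\<in>V. \<exists>i\<in>I. \<exists>j\<in>I.
          x \<noteq> y \<and> x \<noteq> z \<and> y \<noteq> z \<and> i \<noteq> j \<and>
          {x, y} \<in> G i \<and> {x, z} \<in> G i \<and> {y, z} \<in> G j)"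

text \<open>
  \<open>E\<close> is the edge set of some copy of \<open>K\<^bsub>s,t\<^esub>\<close> whose parts partition \<open>V\<close>. A part may be
  empty, as happens for \<open>K\<^bsub>0,1\<^esub>\<close> on a single vertex.
\<close>

definition complete_bipartite_on ::
    "'a set \<Rightarrow> nat \<Rightarrow> nat \<Rightarrow> 'a set set \<Rightarrow> bool" where
  "complete_bipartite_on V s t E \<longleftrightarrow>
     (\<exists>A B. finite A \<and> finite B \<and> A \<union> B = V \<and> A \<inter> B = {} \<and> card A = s \<and> card B = t \<and>
        E = {{a, b} | a b. a \<in> A \<and> b \<in> B})"

end

theory Submission
  imports Defs
begin

text \<open>
  Everything follows from the case of two colours, and there from a bound on the \<^emph>\<open>sum\<close>
  of the edge numbers: \<open>card G + card H \<le> 2 * (n\<^sup>2 div 4)\<close>. This is proved by removing two vertices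
  at a time, as in the classical proof of Mantel's theorem. If \<open>G\<close> and \<open>H\<close> have no common edge, then
  together they have at most \<open>n choose 2\<close> edges, fewer than the bound if \<open>n \<ge> 2\<close>. Otherwise let \<open>{x, y}\<close> be a
  common edge. No vertex \<open>z\<close> can be joined to \<open>x\<close> and to \<open>y\<close>, in whatever colours: the edge \<open>xy\<close>
  can be taken in either colour, and one choice makes the triangle 2-coloured. So
  removing \<open>x\<close> and \<open>y\<close> costs at most \<open>n - 1\<close> edges of each colour, which is exactly the
  increment of \<open>n\<^sup>2 div 4\<close> (lemma \<open>two_colour_sum_bound\<close>). When the bound is attained,
  every other vertex is joined to precisely one of \<open>x\<close>, \<open>y\<close>, and in both colours; inductively the
  rest is a single balanced complete bipartite graph in both colours, and the absence of
  triangles across it forces \<open>x\<close> and \<open>y\<close> to extend its two parts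
  (lemma \<open>two_colour_sum_extremal\<close>).

  For \<open>p\<close> colours, a pairwise bound \<open>e\<^sub>i + e\<^sub>j \<le> 2t\<close> with \<open>t > 0\<close> bounds the product: at most one factor
  exceeds \<open>t\<close>, and if it does so by \<open>d\<close>, then any other factor is at most \<open>t - d\<close>, so that
  these two already multiply to less than \<open>t\<^sup>2\<close>
  (lemmas \<open>prod_le_power_of_pairwise_sum\<close> and \<open>prod_eq_power_of_pairwise_sum\<close>).
\<close>

section \<open>Products of numbers with bounded pairwise sums\<close>

lemma prod_less_power_of_excess:
  fixes f :: "'i \<Rightarrow> nat"
  assumes I: "finite I" "card I \<ge> 2"
    and pair: "\<And>i j. i \<in> I \<Longrightarrow> j \<in> I \<Longrightarrow> i \<noteq> j \<Longrightarrow> f i + f j \<le> 2 * t"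
    and "t > 0" and k: "k \<in> I" "f k > t"
  shows "prod f I < t ^ card I"
proof -
  have "card (I - {k}) \<ge> 1" using I k by simp
  then have "I - {k} \<noteq> {}" by (metis card.empty not_one_le_zero)
  then obtain j where j: "j \<in> I" "j \<noteq> k" by blast
  let ?J = "I - {k} - {j}"
  obtain d where d: "f k = t + d" "d > 0" using k(2) less_imp_add_positive by metis
  have fj: "f j + d \<le> t" using pair[OF j(1) k(1) j(2)] d by simp
  have "f k * f j + d * d \<le> t * t"
  proof -
    obtain s where s: "t = f j + d + s" using fj le_Suc_ex by blast
    show ?thesis unfolding d(1) s by (simp add: algebra_simps)
  qed
  moreover have "d * d > 0" using d(2) by simp
  ultimately have two: "f k * f j < t * t" by linarith
  have "prod f ?J \<le> (\<Prod>i\<in>?J. t)"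
  proof (rule prod_mono)
    fix i assume i: "i \<in> ?J"
    then have "f i + f k \<le> 2 * t" using pair k(1) by blast
    then show "0 \<le> f i \<and> f i \<le> t" using k(2) by simp
  qed
  then have rest: "prod f ?J \<le> t ^ card ?J" by simp
  have cI: "card I = Suc (Suc (card ?J))"
    using I(1) j k(1) by (metis card_Suc_Diff1 finite_Diff insertE insert_Diff)
  have "prod f I = f k * f j * prod f ?J"
    using I(1) j k(1) by (simp add: prod.remove[of I k] prod.remove[of "I - {k}" j] mult.assoc)
  also have "\<dots> \<le> f k * f j * t ^ card ?J" using rest by simp
  also have "\<dots> < t * t * t ^ card ?J" using two \<open>t > 0\<close> by simp
  also have "\<dots> = t ^ card I" using cI by simp
  finally show ?thesis .
qed

lemma prod_le_power_of_pairwise_sum: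
  fixes f :: "'i \<Rightarrow> nat"
  assumes "finite I" "card I \<ge> 2"
    and "\<And>i j. i \<in> I \<Longrightarrow> j \<in> I \<Longrightarrow> i \<noteq> j \<Longrightarrow> f i + f j \<le> 2 * t"
    and "t > 0"
  shows "prod f I \<le> t ^ card I"
proof (cases "\<exists>k\<in>I. f k > t")
  case True
  then show ?thesis using prod_less_power_of_excess[where f = f, OF assms] by (auto simp: less_imp_le)
next
  case False
  then have "prod f I \<le> (\<Prod>i\<in>I. t)" by (intro prod_mono) (auto simp: not_less)
  then show ?thesis by simp
qed

lemma prod_eq_power_of_pairwise_sum:
  fixes f :: "'i \<Rightarrow> nat"
  assumes I: "finite I" "card I \<ge> 2"
    and pair: "\<And>i j. i \<in> I \<Longrightarrow> j \<in> I \<Longrightarrow> i \<noteq> j \<Longrightarrow> f i + f j \<le> 2 * t"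
    and t: "t > 0" and eq: "prod f I = t ^ card I" and "k \<in> I"
  shows "f k = t"
proof (rule ccontr)
  assume "f k \<noteq> t"
  have le: "f i \<le> t" if "i \<in> I" for i
    using prod_less_power_of_excess[where f = f, OF I pair t that] eq by (metis leI less_irrefl)
  with \<open>f k \<noteq> t\<close> \<open>k \<in> I\<close> have less: "f k < t" by (simp add: order_less_le)
  have "prod f (I - {k}) \<le> (\<Prod>i\<in>I - {k}. t)" by (intro prod_mono) (auto simp: le)
  then have rest: "prod f (I - {k}) \<le> t ^ card (I - {k})" by simp
  have "prod f I = f k * prod f (I - {k})" using I \<open>k \<in> I\<close> by (simp add: prod.remove)
  also have "\<dots> \<le> f k * t ^ card (I - {k})" using rest by simp
  also have "\<dots> < t * t ^ card (I - {k})" using less t by simp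
  also have "\<dots> = t ^ card I" using I \<open>k \<in> I\<close> by (metis card_Suc_Diff1 power_Suc)
  finally show False using eq by simp
qed

section \<open>Complete bipartite graphs\<close>

definition bipartite_edges :: "'a set \<Rightarrow> 'a set \<Rightarrow> 'a set set" where
  "bipartite_edges A B = {{a, b} | a b. a \<in> A \<and> b \<in> B}"

lemma bipartite_edges_insert:
  "bipartite_edges (insert x A) (insert y B) =
     bipartite_edges A B \<union> {{x, y}} \<union> (\<lambda>z. {x, z}) ` B \<union> (\<lambda>z. {y, z}) ` A"
  unfolding bipartite_edges_def by (auto simp: insert_commute)

lemma card_bipartite_edges:
  assumes "finite A" "finite B" "A \<inter> B = {}"
  shows "card (bipartite_edges A B) = card A * card B"
proof -
  have "bipartite_edges A B = (\<lambda>(a, b). {a, b}) ` (A \<times> B)"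
    by (auto simp: bipartite_edges_def)
  moreover have "inj_on (\<lambda>(a, b). {a, b}) (A \<times> B)"
    using assms(3) by (auto simp: inj_on_def doubleton_eq_iff)
  ultimately show ?thesis by (simp add: card_image card_cartesian_product)
qed

lemma halves_product: "(n div 2) * ((n + 1) div 2) = n\<^sup>2 div (4::nat)"
proof (cases "even n")
  case True
  then obtain k where "n = 2 * k" by blast
  then show ?thesis by (simp add: power2_eq_square)
next
  case False
  then obtain k where n: "n = 2 * k + 1" by (blast elim: oddE)
  have "n\<^sup>2 = 1 + 4 * (k * (k + 1))" by (simp add: n power2_eq_square algebra_simps)
  then have "n\<^sup>2 div 4 = k * (k + 1)" by simp
  then show ?thesis by (simp add: n)
qed

lemma card_balanced_complete_bipartite:
  assumes "complete_bipartite_on V (n div 2) ((n + 1) div 2) K"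
  shows "card K = n\<^sup>2 div 4"
proof -
  obtain A B where "finite A" "finite B" "A \<inter> B = {}" "card A = n div 2"
      "card B = (n + 1) div 2" "K = bipartite_edges A B"
    using assms unfolding complete_bipartite_on_def bipartite_edges_def by blast
  then show ?thesis by (simp only: card_bipartite_edges halves_product)
qed

section \<open>Two colours\<close>

text \<open>
  Distinctness of \<open>x\<close>, \<open>y\<close>, \<open>z\<close> is implied as soon as \<open>G\<close> and \<open>H\<close> are edge sets,
  because \<open>{x, x}\<close> is then in neither. The relation is not symmetric; two colours without a
  2-coloured triangle satisfy it in both orders.
\<close>

definition no_closed_cherry :: "'a set set \<Rightarrow> 'a set set \<Rightarrow> bool" where
  "no_closed_cherry G H \<longleftrightarrow> (\<forall>x y z. {x, y} \<in> G \<longrightarrow> {x, z} \<in> G \<longrightarrow> {y, z} \<notin> H)"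

lemma no_closed_cherryD:
  "no_closed_cherry G H \<Longrightarrow> {x, y} \<in> G \<Longrightarrow> {x, z} \<in> G \<Longrightarrow> {y, z} \<notin> H"
  by (simp add: no_closed_cherry_def)

lemma no_closed_cherry_mono:
  "no_closed_cherry G H \<Longrightarrow> G' \<subseteq> G \<Longrightarrow> H' \<subseteq> H \<Longrightarrow> no_closed_cherry G' H'"
  unfolding no_closed_cherry_def by blast

lemma doubleton_in_nsets_2: "{x, y} \<in> nsets V 2 \<longleftrightarrow> x \<in> V \<and> y \<in> V \<and> x \<noteq> y"
  by (auto simp: nsets_def card_insert_if)

lemma no_closed_cherry_of_two_coloured_triangle_free:
  assumes tf: "two_coloured_triangle_free V I G" and "i \<in> I" "j \<in> I" "i \<noteq> j"
    and "G i \<subseteq> nsets V 2" "G j \<subseteq> nsets V 2"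
  shows "no_closed_cherry (G i) (G j)"
  unfolding no_closed_cherry_def
proof (intro allI impI notI)
  fix x y z assume e: "{x, y} \<in> G i" "{x, z} \<in> G i" "{y, z} \<in> G j"
  then have "{x, y} \<in> nsets V 2" "{x, z} \<in> nsets V 2" "{y, z} \<in> nsets V 2"
    using assms(5,6) by blast+
  then show False
    using tf e assms(2-4) unfolding two_coloured_triangle_free_def doubleton_in_nsets_2 by blast
qed

definition neighbours_in :: "'a set \<Rightarrow> 'a set set \<Rightarrow> 'a \<Rightarrow> 'a set" where
  "neighbours_in W G x = {z \<in> W. {x, z} \<in> G}"

lemma graph_split_at_edge:
  assumes G: "G \<subseteq> nsets V 2" and xy: "{x, y} \<in> G" and W: "W = V - {x, y}"
  shows "G = G \<inter> nsets W 2 \<union> {{x, y}}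
           \<union> (\<lambda>z. {x, z}) ` neighbours_in W G x \<union> (\<lambda>z. {y, z}) ` neighbours_in W G y"
    (is "G = ?R")
proof
  show "?R \<subseteq> G" using xy by (auto simp: neighbours_in_def)
  show "G \<subseteq> ?R"
  proof
    fix e assume e: "e \<in> G"
    then have "e \<in> nsets V 2" using G by blast
    then obtain u v where uv: "e = {u, v}" "u \<in> V" "v \<in> V" "u \<noteq> v"
      by (auto simp: nsets_def card_2_iff)
    consider "u \<in> W" "v \<in> W" | "u = x" "v = y" | "u = y" "v = x" | "u = x" "v \<in> W"
      | "u = y" "v \<in> W" | "v = x" "u \<in> W" | "v = y" "u \<in> W"
      using uv W by blast
    then show "e \<in> ?R"
    proof cases
      case 1
      then show ?thesis using e uv by (simp add: doubleton_in_nsets_2)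
    qed (use e uv in \<open>auto simp: neighbours_in_def insert_commute\<close>)
  qed
qed

text \<open>
  Removing the ends of an edge \<open>{x, y}\<close> of both graphs costs \<open>G\<close> that edge and, since a common
  \<open>G\<close>-neighbour of \<open>x\<close> and \<open>y\<close> would be the apex of a cherry closed by the \<open>H\<close>-copy of
  \<open>{x, y}\<close>, at most one edge for each remaining vertex.
\<close>

lemma card_remove_common_edge:
  assumes "finite V" and G: "G \<subseteq> nsets V 2" and xy: "{x, y} \<in> G" "{x, y} \<in> H"
    and nc: "no_closed_cherry G H" and W: "W = V - {x, y}"
  shows "neighbours_in W G x \<inter> neighbours_in W G y = {}"
    and "card G \<le> card (G \<inter> nsets W 2) + 1 + card (neighbours_in W G x \<union> neighbours_in W G y)"
proof -
  let ?Nx = "neighbours_in W G x" and ?Ny = "neighbours_in W G y"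
  have fin: "finite ?Nx" "finite ?Ny" using assms(1) W by (auto simp: neighbours_in_def)
  show disj: "?Nx \<inter> ?Ny = {}"
    using no_closed_cherryD[OF nc, of _ x y] xy(2) by (auto simp: neighbours_in_def insert_commute)
  have "card G = card (G \<inter> nsets W 2 \<union> {{x, y}} \<union> (\<lambda>z. {x, z}) ` ?Nx \<union> (\<lambda>z. {y, z}) ` ?Ny)"
    using graph_split_at_edge[OF G xy(1) W] by simp
  also have "\<dots> \<le> card (G \<inter> nsets W 2) + card {{x, y}}
      + card ((\<lambda>z. {x, z}) ` ?Nx) + card ((\<lambda>z. {y, z}) ` ?Ny)"
    by (meson add_mono card_Un_le order_refl order_trans)
  also have "\<dots> \<le> card (G \<inter> nsets W 2) + 1 + card ?Nx + card ?Ny"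
    using card_image_le fin by (intro add_mono) auto
  finally show "card G \<le> card (G \<inter> nsets W 2) + 1 + card (?Nx \<union> ?Ny)"
    using card_Un_disjoint[OF fin disj] by simp
qed

lemma square_div_4_add_2: "(m + 2)\<^sup>2 div 4 = m\<^sup>2 div 4 + m + (1::nat)"
proof -
  have "(m + 2)\<^sup>2 = m\<^sup>2 + 4 * (m + 1)" by (simp add: power2_eq_square algebra_simps)
  then show ?thesis by simp
qed

text \<open>
  The strict inequality is what guarantees a common edge in the case of equality. It passes from
  \<open>m - 2\<close> to \<open>m\<close>, since the left side grows by \<open>2 * m + 1\<close> and the right side by
  \<open>2 * m + 2\<close>.
\<close>

lemma choose_two_less_twice_square_div_4:
  "(m + 2) choose 2 < 2 * ((m + 2)\<^sup>2 div (4::nat))"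
proof (induction m rule: less_induct)
  case (less m)
  show ?case
  proof (cases "m < 2")
    case True
    then have "m = 0 \<or> m = 1" by auto
    then show ?thesis by (auto simp: choose_two power2_eq_square)
  next
    case False
    then obtain k where m: "m = k + 2" by (metis add.commute le_Suc_ex not_less)
    have "(m + 2) choose 2 = ((k + 2) choose 2) + 2 * k + 5"
      unfolding m by (simp add: numeral_eq_Suc)
    moreover have "(m + 2)\<^sup>2 div 4 = (k + 2)\<^sup>2 div 4 + k + 3"
      using square_div_4_add_2[of "k + 2"] unfolding m by linarith
    moreover have "(k + 2) choose 2 < 2 * ((k + 2)\<^sup>2 div 4)" using less.IH[of k] m by linarith
    ultimately show ?thesis by linarith
  qed
qed

lemma card_sum_of_disjoint_graphs:
  assumes "finite V" "card V = m + 2" "G \<subseteq> nsets V 2" "H \<subseteq> nsets V 2" "G \<inter> H = {}"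
  shows "card G + card H < 2 * ((m + 2)\<^sup>2 div 4)"
proof -
  have fin: "finite (nsets V 2)" using assms(1) by (simp add: finite_imp_finite_nsets)
  have "card G + card H = card (G \<union> H)"
    using assms fin by (metis card_Un_disjoint finite_subset)
  also have "\<dots> \<le> card (nsets V 2)" using assms(3,4) fin by (intro card_mono) auto
  also have "\<dots> = (m + 2) choose 2" using assms(2) by (simp add: card_nsets)
  also have "\<dots> < 2 * ((m + 2)\<^sup>2 div 4)" by (rule choose_two_less_twice_square_div_4)
  finally show ?thesis .
qed

lemma two_colour_sum_bound:
  assumes "finite V" "card V = n" "G \<subseteq> nsets V 2" "H \<subseteq> nsets V 2"
    and "no_closed_cherry G H" "no_closed_cherry H G"
  shows "card G + card H \<le> 2 * (n\<^sup>2 div 4)"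
  using assms
proof (induction n arbitrary: V G H rule: less_induct)
  case (less n)
  show ?case
  proof (cases "n < 2")
    case True
    then have "nsets V 2 = {}" using less.prems(1,2) by (simp add: nsets_eq_empty_iff)
    then show ?thesis using less.prems by simp
  next
    case False
    then obtain m where n: "n = m + 2" by (metis add.commute le_Suc_ex not_less)
    show ?thesis
    proof (cases "G \<inter> H = {}")
      case True
      then show ?thesis using card_sum_of_disjoint_graphs[of V m G H] less.prems n by simp
    next
      case False
      then obtain e where e: "e \<in> G" "e \<in> H" by blast
      then obtain x y where xy: "e = {x, y}" "x \<in> V" "y \<in> V" "x \<noteq> y"
        using less.prems(3) by (auto simp: nsets_def card_2_iff)
      define W where "W = V - {x, y}"
      have W: "finite W" "card W = m"
        using less.prems(1,2) xy n by (auto simp: W_def card_Diff_subset)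
      have nb: "card (neighbours_in W F x \<union> neighbours_in W F y) \<le> m" for F
        using W
        by (metis (no_types, lifting) Un_least card_mono mem_Collect_eq neighbours_in_def subsetI)
      have "card G \<le> card (G \<inter> nsets W 2) + 1 + m"
        using card_remove_common_edge(2)[of V G x y H W] nb[of G] less.prems e xy W_def by fastforce
      moreover have "card H \<le> card (H \<inter> nsets W 2) + 1 + m"
        using card_remove_common_edge(2)[of V H x y G W] nb[of H] less.prems e xy W_def by fastforce
      moreover have "card (G \<inter> nsets W 2) + card (H \<inter> nsets W 2) \<le> 2 * (m\<^sup>2 div 4)"
        using less.prems n W by (intro less.IH[of m W]) (auto intro: no_closed_cherry_mono)
      ultimately show ?thesis using square_div_4_add_2[of m] n by simp
    qed
  qed
qed

text \<open>
  Adding adjacent vertices \<open>x\<close>, \<open>y\<close> to a complete bipartite graph whose every vertex is to be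
  joined to exactly one of them: an edge \<open>{a, b}\<close> across the parts must not have both ends joined
  to the same new vertex, so once one vertex of \<open>A\<close> has chosen, all choices are determined. Only
  when \<open>A\<close> is empty is there no such edge; then \<open>card B \<le> 1\<close> leaves no room for a mixed choice.
\<close>

lemma neighbourhood_of_new_vertex:
  assumes part: "A \<union> B = W" and disj: "A \<inter> B = {}" and fin: "finite A" "finite B"
    and card: "card A \<le> card B" "card B \<le> card A + 1"
    and N: "Nx \<union> Ny = W" "Nx \<inter> Ny = {}"
    and free: "\<And>a b. a \<in> A \<Longrightarrow> b \<in> B \<Longrightarrow> \<not> (a \<in> Nx \<and> b \<in> Nx) \<and> \<not> (a \<in> Ny \<and> b \<in> Ny)"
  shows "Nx = A \<and> Ny = B \<or> Nx = B \<and> Ny = A"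
proof (cases "A = {}")
  case True
  then have "card B = 0 \<or> card B = 1" using card by auto
  then consider "B = {}" | b where "B = {b}" using fin by (auto simp: card_1_singleton_iff)
  then show ?thesis
  proof cases
    case 1
    then show ?thesis using True part disj N by auto
  next
    case 2
    then have "Nx \<union> Ny = {b}" using True part N(1) by simp
    then have "Nx = {} \<and> Ny = {b} \<or> Nx = {b} \<and> Ny = {}"
      using N(2) by (metis Un_singleton_iff Int_absorb insert_not_empty)
    then show ?thesis using True 2 by simp
  qed
next
  case False
  then obtain a where a: "a \<in> A" by blast
  then have "B \<noteq> {}" using card(1) fin(1) by auto
  then obtain b where b: "b \<in> B" by blast
  have "a \<in> Nx \<or> a \<in> Ny" using a part N(1) by blast
  then show ?thesis
  proof
    assume "a \<in> Nx"
    then have B: "B \<subseteq> Ny" using free[OF a] part N(1) by blast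
    then have "A \<subseteq> Nx" using free[OF _ b] b part N(1) by blast
    then show ?thesis using B part disj N by blast
  next
    assume "a \<in> Ny"
    then have B: "B \<subseteq> Nx" using free[OF a] part N(1) by blast
    then have "A \<subseteq> Ny" using free[OF _ b] b part N(1) by blast
    then show ?thesis using B part disj N by blast
  qed
qed

text \<open>
  Equality forces equality in every step of the bound, so that the neighbourhoods of \<open>x\<close> and
  \<open>y\<close> partition the remaining vertices in each colour; since no vertex may be joined to \<open>x\<close>
  in one colour and to \<open>y\<close> in the other, the two colours yield the same partition.
\<close>

lemma two_colour_sum_extremal:
  assumes "finite V" "card V = n" "G \<subseteq> nsets V 2" "H \<subseteq> nsets V 2"
    and "no_closed_cherry G H" "no_closed_cherry H G"
    and "card G + card H = 2 * (n\<^sup>2 div 4)"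
  shows "G = H \<and> complete_bipartite_on V (n div 2) ((n + 1) div 2) G"
  using assms
proof (induction n arbitrary: V G H rule: less_induct)
  case (less n)
  show ?case
  proof (cases "n < 2")
    case True
    then have "nsets V 2 = {}" using less.prems(1,2) by (simp add: nsets_eq_empty_iff)
    then have "G = {}" "H = {}" using less.prems(3,4) by auto
    moreover have "complete_bipartite_on V (n div 2) ((n + 1) div 2) {}"
      unfolding complete_bipartite_on_def
      by (rule exI[of _ "{}"], rule exI[of _ V]) (use True less.prems(1,2) in auto)
    ultimately show ?thesis by simp
  next
    case False
    then obtain m where n: "n = m + 2" by (metis add.commute le_Suc_ex not_less)
    have "G \<inter> H \<noteq> {}"
      using card_sum_of_disjoint_graphs[of V m G H] less.prems n by (metis less_irrefl)
    then obtain e where e: "e \<in> G" "e \<in> H" by blast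
    then obtain x y where xy: "e = {x, y}" "x \<in> V" "y \<in> V" "x \<noteq> y"
      using less.prems(3) by (auto simp: nsets_def card_2_iff)
    have ed: "{x, y} \<in> G" "{x, y} \<in> H" using e xy by auto
    define W where "W = V - {x, y}"
    have W: "finite W" "card W = m"
      using less.prems(1,2) xy n by (auto simp: W_def card_Diff_subset)
    have sub: "neighbours_in W F v \<subseteq> W" for F v by (auto simp: neighbours_in_def)
    have nb: "card (neighbours_in W F x \<union> neighbours_in W F y) \<le> m" for F
      using W sub by (metis Un_least card_mono)
    note G_cost = card_remove_common_edge[OF less.prems(1,3) ed less.prems(5) W_def]
    note H_cost = card_remove_common_edge[OF less.prems(1,4) ed(2,1) less.prems(6) W_def]
    let ?G = "G \<inter> nsets W 2" and ?H = "H \<inter> nsets W 2"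
    have rest: "no_closed_cherry ?G ?H" "no_closed_cherry ?H ?G"
      using less.prems(5,6) by (auto intro: no_closed_cherry_mono)
    have bound: "card ?G + card ?H \<le> 2 * (m\<^sup>2 div 4)"
      using two_colour_sum_bound[OF W _ _ rest] by simp
    note nbG = nb[of G] and nbH = nb[of H]
    have total: "card G + card H = 2 * (m\<^sup>2 div 4) + 2 * m + 2"
      using less.prems(7) square_div_4_add_2[of m] n by simp
    have "card ?G + card ?H = 2 * (m\<^sup>2 div 4)"
      and cN: "card (neighbours_in W G x \<union> neighbours_in W G y) = m"
        "card (neighbours_in W H x \<union> neighbours_in W H y) = m"
      using G_cost(2) H_cost(2) nbG nbH bound total by linarith+
    then have "?G = ?H \<and> complete_bipartite_on W (m div 2) ((m + 1) div 2) ?G"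
      using rest W n by (intro less.IH) auto
    then obtain A B where AB: "finite A" "finite B" "A \<union> B = W" "A \<inter> B = {}"
        "card A = m div 2" "card B = (m + 1) div 2"
      and GH: "?G = bipartite_edges A B" "?H = bipartite_edges A B"
      unfolding complete_bipartite_on_def bipartite_edges_def by auto
    have NG: "neighbours_in W G x \<union> neighbours_in W G y = W"
      and NH: "neighbours_in W H x \<union> neighbours_in W H y = W"
      using cN W sub by (metis Un_least card_subset_eq)+
    have "neighbours_in W G x \<inter> neighbours_in W H y = {}"
      using no_closed_cherryD[OF less.prems(5) ed(1)] by (auto simp: neighbours_in_def)
    moreover have "neighbours_in W G y \<inter> neighbours_in W H x = {}"
      using no_closed_cherryD[OF less.prems(5), of y x] ed(1)
      by (auto simp: neighbours_in_def insert_commute)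
    ultimately have same: "neighbours_in W H x = neighbours_in W G x"
        "neighbours_in W H y = neighbours_in W G y"
      using NG NH G_cost(1) H_cost(1) by blast+
    have free: "\<not> (a \<in> neighbours_in W G v \<and> b \<in> neighbours_in W G v)"
      if "a \<in> A" "b \<in> B" for a b v
    proof -
      have "{a, b} \<in> ?H" unfolding GH(2) bipartite_edges_def using that by blast
      then show ?thesis
        using no_closed_cherryD[OF less.prems(5), of v a b] by (auto simp: neighbours_in_def)
    qed
    have cases: "neighbours_in W G x = A \<and> neighbours_in W G y = B
        \<or> neighbours_in W G x = B \<and> neighbours_in W G y = A"
      using AB by (intro neighbourhood_of_new_vertex[OF AB(3,4,1,2) _ _ NG G_cost(1)])
        (auto simp: free)
    note splitG = graph_split_at_edge[OF less.prems(3) ed(1) W_def]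
      and splitH = graph_split_at_edge[OF less.prems(4) ed(2) W_def]
    have "G = H" using splitG splitH GH same by simp
    \<comment> \<open>The new vertex joined to \<open>B\<close> is added to \<open>A\<close>, and conversely.\<close>
    moreover have "\<exists>u v. {u, v} = {x, y} \<and> G = bipartite_edges (insert u A) (insert v B)"
      using cases
    proof
      assume N: "neighbours_in W G x = A \<and> neighbours_in W G y = B"
      have "G = bipartite_edges (insert y A) (insert x B)"
        unfolding bipartite_edges_insert
        by (subst splitG) (simp add: N GH insert_commute[of x y "{}"] Un_ac)
      then show ?thesis by blast
    next
      assume N: "neighbours_in W G x = B \<and> neighbours_in W G y = A"
      have "G = bipartite_edges (insert x A) (insert y B)"
        unfolding bipartite_edges_insert by (subst splitG) (simp add: N GH)
      then show ?thesis by blast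
    qed
    then obtain u v where uv: "{u, v} = {x, y}"
      and Guv: "G = bipartite_edges (insert u A) (insert v B)"
      by blast
    have "u \<in> V" "v \<in> V" "u \<noteq> v" "u \<notin> W" "v \<notin> W" "V = insert u (insert v W)"
      using uv xy unfolding W_def by (auto simp: doubleton_eq_iff)
    then have "complete_bipartite_on V (n div 2) ((n + 1) div 2) G"
      unfolding complete_bipartite_on_def Guv bipartite_edges_def
      by (intro exI[of _ "insert u A"] exI[of _ "insert v B"]) (use AB n in auto)
    ultimately show ?thesis by blast
  qed
qed

section \<open>Any number of colours\<close>

theorem corollary1p9:
  fixes n p :: nat and G :: "nat \<Rightarrow> nat set set"
  assumes "n \<ge> 1" and "p \<ge> 2"
    and "\<And>i. i \<in> {1..p} \<Longrightarrow> G i \<subseteq> nsets {1..n} 2"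
    and "two_coloured_triangle_free {1..n} {1..p} G"
  shows "(\<Prod>i\<in>{1..p}. card (G i)) \<le> (n\<^sup>2 div 4) ^ p \<and>
         ((\<Prod>i\<in>{1..p}. card (G i)) = (n\<^sup>2 div 4) ^ p \<longleftrightarrow>
          (\<exists>K. complete_bipartite_on {1..n} (n div 2) ((n + 1) div 2) K \<and>
               (\<forall>i\<in>{1..p}. G i = K)))"
proof -
  let ?t = "n\<^sup>2 div 4"
  let ?bal = "complete_bipartite_on {1..n} (n div 2) ((n + 1) div 2)"
  have V: "finite {1..n}" "card {1..n} = n" by simp_all
  have cherry: "no_closed_cherry (G i) (G j)" if "i \<in> {1..p}" "j \<in> {1..p}" "i \<noteq> j" for i j
    using no_closed_cherry_of_two_coloured_triangle_free[OF assms(4) that] assms(3) that by blast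
  have sum: "card (G i) + card (G j) \<le> 2 * ?t" if "i \<in> {1..p}" "j \<in> {1..p}" "i \<noteq> j" for i j
    using two_colour_sum_bound[OF V assms(3) assms(3) cherry cherry] that by metis
  have extremal: "G i = G j \<and> ?bal (G i)"
    if "i \<in> {1..p}" "j \<in> {1..p}" "i \<noteq> j" "card (G i) = ?t" "card (G j) = ?t" for i j
    using two_colour_sum_extremal[OF V assms(3) assms(3) cherry cherry] that by simp
  have I: "finite {1..p}" "card {1..p} \<ge> 2" using assms(2) by auto
  have bound_and_sizes: "(\<Prod>i\<in>{1..p}. card (G i)) \<le> ?t ^ p \<and>
      ((\<Prod>i\<in>{1..p}. card (G i)) = ?t ^ p \<longrightarrow> (\<forall>i\<in>{1..p}. card (G i) = ?t))"
  proof (cases "n = 1")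
    \<comment> \<open>Here \<open>n\<^sup>2 div 4 = 0\<close>, so a product says nothing about its factors; but there are no edges.\<close>
    case True
    then have "nsets {1..n} 2 = {}" by (simp add: nsets_eq_empty_iff)
    then have "card (G i) = 0" if "i \<in> {1..p}" for i using assms(3)[OF that] by simp
    then show ?thesis using True assms(2) by (auto simp: power_0_left)
  next
    case False
    then have "2 \<le> n" using assms(1) by simp
    then have "2 * 2 \<le> n * n" by (intro mult_mono) auto
    then have t: "?t > 0" by (simp add: power2_eq_square div_greater_zero_iff)
    show ?thesis
      using prod_le_power_of_pairwise_sum[where f = "\<lambda>i. card (G i)", OF I sum t]
        prod_eq_power_of_pairwise_sum[where f = "\<lambda>i. card (G i)", OF I sum t]
      by simp
  qed
  have "\<exists>K. ?bal K \<and> (\<forall>i\<in>{1..p}. G i = K)"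
    if "(\<Prod>i\<in>{1..p}. card (G i)) = ?t ^ p"
  proof -
    have size: "card (G i) = ?t" if "i \<in> {1..p}" for i
      using bound_and_sizes \<open>(\<Prod>i\<in>{1..p}. card (G i)) = ?t ^ p\<close> that by blast
    have one: "1 \<in> {1..p}" and two: "2 \<in> {1..p}" using assms(2) by auto
    have "?bal (G 1)"
      by (rule conjunct2[OF extremal[OF one two _ size[OF one] size[OF two]]]) simp
    moreover have "G i = G 1" if "i \<in> {1..p}" for i
      using extremal[OF one that] size one that by (cases "i = 1") auto
    ultimately show ?thesis by blast
  qed
  moreover have "(\<Prod>i\<in>{1..p}. card (G i)) = ?t ^ p"
    if "\<exists>K. ?bal K \<and> (\<forall>i\<in>{1..p}. G i = K)"
    using that card_balanced_complete_bipartite by fastforce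
  ultimately show ?thesis using bound_and_sizes by blast
qed

end
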